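(* Let $\delta\in\mathbb{C}$ and let $(G,\cdot,\{\cdot,\cdot\})$ be a complex vector space with two bilinear operations. (1) If $\delta\neq\frac12$ and $(G,\cdot,\{\cdot,\cdot\})$ is a commutative $\delta$-Gelfand--Dorfman algebra (i.e. a $\delta$-Gelfand--Dorfman algebra in which $\cdot$ is commutative), then it is a transposed $(\delta+1)$-Poisson algebra. (2) Conversely, if $\delta\neq-1$ and $(G,\cdot,\{\cdot,\cdot\})$ is a transposed $(\delta+1)$-Poisson algebra, then it is a commutative $\delta$-Gelfand--Dorfman algebra.
   Context: A (left) $\delta$-Novikov algebra is an algebra $(G,\circ)$ satisfying $\delta(x\circ y)\circ z-x\circ(y\circ z)=\delta(y\circ x)\circ z-y\circ(x\circ z)$ and $(x\circ y)\circ z=(x\circ z)\circ y$. A $\delta$-Gelfand--Dorfman algebra is a triple $(G,\circ,\{\cdot,\cdot\})$ such that $(G,\circ)$ is a $\delta$-Novikov algebra, $(G,\{\cdot,\cdot\})$ is a Lie algebra, and for all $a,b,c\in G$: $\{a,b\circ c\}-\{c,b\circ a\}+\delta\{b,a\}\circ c-\delta\{b,c\}\circ a-b\circ\{a,c\}=0$. For $\gamma\in\mathbb{C}$, a transposed $\gamma$-Poisson algebra is a triple $(P,\cdot,\{\cdot,\cdot\})$ such that $(P,\cdot)$ is a commutative associative algebra, $(P,\{\cdot,\cdot\})$ is a Lie algebra, and $\gamma\, x\{y,z\}=\{xy,z\}+\{y,xz\}$ for all $x,y,z\in P$. *)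

theory Defs
  imports Complex_Main
begin

locale complex_algebra = vector_space scale
  for scale :: "complex \<Rightarrow> 'a::ab_group_add \<Rightarrow> 'a" (infixr "*s" 75) +
  fixes mult :: "'a \<Rightarrow> 'a \<Rightarrow> 'a" (infixl "\<cdot>" 70)
  assumes linear_left: "Vector_Spaces.linear scale scale (\<lambda>x. x \<cdot> y)"
    and linear_right: "Vector_Spaces.linear scale scale (\<lambda>y. x \<cdot> y)"

locale complex_lie_algebra = complex_algebra scale bracket
  for scale :: "complex \<Rightarrow> 'a::ab_group_add \<Rightarrow> 'a" (infixr "*s" 75)
    and bracket :: "'a \<Rightarrow> 'a \<Rightarrow> 'a" ("\<lbrace>_, _\<rbrace>") +
  assumes alternating: "\<lbrace>x, x\<rbrace> = 0"
    and jacobi: "\<lbrace>x, \<lbrace>y, z\<rbrace>\<rbrace> + \<lbrace>y, \<lbrace>z, x\<rbrace>\<rbrace> + \<lbrace>z, \<lbrace>x, y\<rbrace>\<rbrace> = 0"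

locale delta_novikov_algebra = complex_algebra scale mult
  for \<delta> :: complex
    and scale :: "complex \<Rightarrow> 'a::ab_group_add \<Rightarrow> 'a" (infixr "*s" 75)
    and mult :: "'a \<Rightarrow> 'a \<Rightarrow> 'a" (infixl "\<cdot>" 70) +
  assumes delta_left_symmetric:
      "\<delta> *s ((x \<cdot> y) \<cdot> z) - x \<cdot> (y \<cdot> z) = \<delta> *s ((y \<cdot> x) \<cdot> z) - y \<cdot> (x \<cdot> z)"
    and right_commutative: "(x \<cdot> y) \<cdot> z = (x \<cdot> z) \<cdot> y"

locale delta_gelfand_dorfman_algebra =
  delta_novikov_algebra \<delta> scale mult + lie: complex_lie_algebra scale bracket
  for \<delta> :: complex
    and scale :: "complex \<Rightarrow> 'a::ab_group_add \<Rightarrow> 'a" (infixr "*s" 75)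
    and mult :: "'a \<Rightarrow> 'a \<Rightarrow> 'a" (infixl "\<cdot>" 70)
    and bracket :: "'a \<Rightarrow> 'a \<Rightarrow> 'a" ("\<lbrace>_, _\<rbrace>") +
  assumes gelfand_dorfman:
    "\<lbrace>a, b \<cdot> c\<rbrace> - \<lbrace>c, b \<cdot> a\<rbrace> + \<delta> *s (\<lbrace>b, a\<rbrace> \<cdot> c) - \<delta> *s (\<lbrace>b, c\<rbrace> \<cdot> a) - b \<cdot> \<lbrace>a, c\<rbrace> = 0"

locale commutative_delta_gelfand_dorfman_algebra =
  delta_gelfand_dorfman_algebra \<delta> scale mult bracket
  for \<delta> :: complex
    and scale :: "complex \<Rightarrow> 'a::ab_group_add \<Rightarrow> 'a" (infixr "*s" 75)
    and mult :: "'a \<Rightarrow> 'a \<Rightarrow> 'a" (infixl "\<cdot>" 70)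
    and bracket :: "'a \<Rightarrow> 'a \<Rightarrow> 'a" ("\<lbrace>_, _\<rbrace>") +
  assumes commutative: "x \<cdot> y = y \<cdot> x"

locale commutative_associative_complex_algebra = complex_algebra scale mult
  for scale :: "complex \<Rightarrow> 'a::ab_group_add \<Rightarrow> 'a" (infixr "*s" 75)
    and mult :: "'a \<Rightarrow> 'a \<Rightarrow> 'a" (infixl "\<cdot>" 70) +
  assumes commutative: "x \<cdot> y = y \<cdot> x"
    and associative: "(x \<cdot> y) \<cdot> z = x \<cdot> (y \<cdot> z)"

locale transposed_poisson_algebra =
  commutative_associative_complex_algebra scale mult + lie: complex_lie_algebra scale bracket
  for \<gamma> :: complex
    and scale :: "complex \<Rightarrow> 'a::ab_group_add \<Rightarrow> 'a" (infixr "*s" 75)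
    and mult :: "'a \<Rightarrow> 'a \<Rightarrow> 'a" (infixl "\<cdot>" 70)
    and bracket :: "'a \<Rightarrow> 'a \<Rightarrow> 'a" ("\<lbrace>_, _\<rbrace>") +
  assumes transposed_leibniz:
    "\<gamma> *s (x \<cdot> \<lbrace>y, z\<rbrace>) = \<lbrace>x \<cdot> y, z\<rbrace> + \<lbrace>y, x \<cdot> z\<rbrace>"

end

theory Submission
  imports Defs
begin

text \<open>
  In the commutative case, right commutativity and associativity are the same condition, and
  both sides of the left symmetry law equal \<open>(\<delta> - 1) xyz\<close>.  So only the compatibility between
  product and bracket matters.  Put
  \<open>L(b; a, c) = {ba, c} + {a, bc}\<close> and \<open>S(a, b, c) = a{b, c} + b{c, a} + c{a, b}\<close>.  The
  transposed Leibniz rule with parameter \<open>\<delta> + 1\<close> says \<open>L(b; a, c) = (\<delta> + 1) b{a, c}\<close>,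
  while the Gelfand--Dorfman identity says \<open>L(b; a, c) = (\<delta> + 1) b{a, c} + \<delta> S(a, b, c)\<close>
  (lemma \<open>gelfand_dorfman_iff\<close>).  The two agree as soon as \<open>S\<close> vanishes.

  Either law forces this.  By skew-symmetry the sum of \<open>L\<close> over cyclic permutations of
  \<open>a, b, c\<close> is zero (\<open>cyclic_sum_leibniz_sum\<close>), whereas the cyclic sum of
  \<open>b{a, c}\<close> is \<open>-S\<close>.  Summing the transposed Leibniz rule therefore gives \<open>(\<delta> + 1) S = 0\<close>, and
  summing the Gelfand--Dorfman identity gives \<open>(2\<delta> - 1) S = 0\<close> (\<open>cyclic_sum_eq_0\<close>);
  these are the sources of the excluded values \<open>\<delta> = -1\<close> and \<open>\<delta> = 1/2\<close>.
\<close>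

locale commutative_associative_lie_algebra =
  commutative_associative_complex_algebra scale mult + lie: complex_lie_algebra scale bracket
  for scale :: "complex \<Rightarrow> 'a::ab_group_add \<Rightarrow> 'a" (infixr "*s" 75)
    and mult :: "'a \<Rightarrow> 'a \<Rightarrow> 'a" (infixl "\<cdot>" 70)
    and bracket :: "'a \<Rightarrow> 'a \<Rightarrow> 'a" ("\<lbrace>_, _\<rbrace>")
begin

definition leibniz_sum :: "'a \<Rightarrow> 'a \<Rightarrow> 'a \<Rightarrow> 'a" where
  "leibniz_sum b a c = \<lbrace>b \<cdot> a, c\<rbrace> + \<lbrace>a, b \<cdot> c\<rbrace>"

definition cyclic_sum :: "'a \<Rightarrow> 'a \<Rightarrow> 'a \<Rightarrow> 'a" where
  "cyclic_sum a b c = a \<cdot> \<lbrace>b, c\<rbrace> + b \<cdot> \<lbrace>c, a\<rbrace> + c \<cdot> \<lbrace>a, b\<rbrace>"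

lemma bracket_skew: "\<lbrace>x, y\<rbrace> = - \<lbrace>y, x\<rbrace>"
proof -
  have "\<lbrace>x + y, x + y\<rbrace> = (\<lbrace>x, x\<rbrace> + \<lbrace>y, x\<rbrace>) + (\<lbrace>x, y\<rbrace> + \<lbrace>y, y\<rbrace>)"
    by (simp only: lie.linear_left[THEN module_hom_linearI, THEN module_hom.add]
        lie.linear_right[THEN module_hom_linearI, THEN module_hom.add])
  then show ?thesis
    by (simp add: lie.alternating eq_neg_iff_add_eq_0 add.commute)
qed

lemma mult_bracket_skew: "x \<cdot> \<lbrace>y, z\<rbrace> = - (x \<cdot> \<lbrace>z, y\<rbrace>)"
  by (subst bracket_skew) (rule linear_right[THEN module_hom_linearI, THEN module_hom.neg])

lemma cyclic_sum_rotate: "cyclic_sum b c a = cyclic_sum a b c"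
  by (simp add: cyclic_sum_def ac_simps)

text \<open>Each of the three products of two variables occurs twice, once in the first slot of a
  bracket and once in the second, so the six terms cancel in pairs.\<close>

lemma cyclic_sum_leibniz_sum:
  "leibniz_sum a b c + leibniz_sum b c a + leibniz_sum c a b = 0"
  using bracket_skew[of "a \<cdot> b" c] bracket_skew[of "b \<cdot> c" a] bracket_skew[of "c \<cdot> a" b]
  by (simp add: leibniz_sum_def commutative[of b a] commutative[of c b] commutative[of a c])

lemma gelfand_dorfman_iff:
  "\<lbrace>a, b \<cdot> c\<rbrace> - \<lbrace>c, b \<cdot> a\<rbrace> + \<delta> *s (\<lbrace>b, a\<rbrace> \<cdot> c) - \<delta> *s (\<lbrace>b, c\<rbrace> \<cdot> a) - b \<cdot> \<lbrace>a, c\<rbrace> = 0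
    \<longleftrightarrow> leibniz_sum b a c = (\<delta> + 1) *s (b \<cdot> \<lbrace>a, c\<rbrace>) + \<delta> *s cyclic_sum a b c"
proof -
  have "\<lbrace>b, a\<rbrace> \<cdot> c = - (c \<cdot> \<lbrace>a, b\<rbrace>)"
    using mult_bracket_skew[of c b a] by (simp add: commutative)
  moreover have "\<lbrace>b, c\<rbrace> \<cdot> a = a \<cdot> \<lbrace>b, c\<rbrace>"
    by (rule commutative)
  ultimately show ?thesis
    using bracket_skew[of c "b \<cdot> a"] mult_bracket_skew[of b a c]
    by (simp add: leibniz_sum_def cyclic_sum_def scale_left_distrib scale_right_distrib
        scale_minus_right algebra_simps)
qed

text \<open>Summing the hypothesis cyclically gives \<open>(\<delta> + 1 - 3\<mu>) S = 0\<close>: the sum \<open>S\<close> is invariant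
  under cyclic permutations, so its contributions add up instead of cancelling.  The
  Gelfand--Dorfman identity is the case \<open>\<mu> = \<delta>\<close>, and the transposed Leibniz rule is the case
  \<open>\<mu> = 0\<close>.\<close>

lemma cyclic_sum_eq_0:
  assumes law: "\<And>a b c. leibniz_sum b a c = (\<delta> + 1) *s (b \<cdot> \<lbrace>a, c\<rbrace>) + \<mu> *s cyclic_sum a b c"
    and nondegenerate: "3 * \<mu> \<noteq> \<delta> + 1"
  shows "cyclic_sum a b c = 0"
proof -
  let ?S = "cyclic_sum a b c"
  \<comment> \<open>Written for \<open>leibniz_sum a b c\<close> and its rotations, \<open>law\<close> involves the odd permutations of
    the arguments of \<open>cyclic_sum\<close>.\<close>
  have "cyclic_sum b a c = - ?S"
    using mult_bracket_skew[of a c b] mult_bracket_skew[of b a c] mult_bracket_skew[of c b a]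
    by (simp add: cyclic_sum_def algebra_simps)
  then have odd: "cyclic_sum b a c = - ?S" "cyclic_sum c b a = - ?S" "cyclic_sum a c b = - ?S"
    using cyclic_sum_rotate[of b a c] cyclic_sum_rotate[of c b a] by simp_all
  have "0 = leibniz_sum a b c + leibniz_sum b c a + leibniz_sum c a b"
    by (simp only: cyclic_sum_leibniz_sum)
  also have "\<dots> = (\<delta> + 1) *s (a \<cdot> \<lbrace>b, c\<rbrace> + b \<cdot> \<lbrace>c, a\<rbrace> + c \<cdot> \<lbrace>a, b\<rbrace>)
      - (\<mu> *s ?S + \<mu> *s ?S + \<mu> *s ?S)"
    by (simp only: law odd scale_right_distrib scale_minus_right) simp
  also have "\<dots> = (\<delta> + 1) *s ?S - (\<mu> + \<mu> + \<mu>) *s ?S"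
    by (simp only: cyclic_sum_def scale_left_distrib)
  also have "\<dots> = (\<delta> + 1 - 3 * \<mu>) *s ?S"
    by (simp flip: scale_left_diff_distrib)
  finally show ?thesis
    using nondegenerate by simp
qed

end

text \<open>Right commutativity becomes associativity once the factors of a product may be exchanged:
  \<open>(xy)z = (yx)z = (yz)x = x(yz)\<close>.\<close>

lemma (in commutative_delta_gelfand_dorfman_algebra) commutative_associative_lie:
  "commutative_associative_lie_algebra scale mult bracket"
proof unfold_locales
  show "x \<cdot> y = y \<cdot> x" for x y
    by (rule commutative)
  show "(x \<cdot> y) \<cdot> z = x \<cdot> (y \<cdot> z)" for x y z
    by (metis commutative right_commutative)
qed

theorem theorem46:
  fixes \<delta> :: complex
    and scale :: "complex \<Rightarrow> 'a::ab_group_add \<Rightarrow> 'a"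
    and mult bracket :: "'a \<Rightarrow> 'a \<Rightarrow> 'a"
  assumes "complex_algebra scale mult"
    and "complex_algebra scale bracket"
  shows "(\<delta> \<noteq> 1 / 2 \<longrightarrow>
           commutative_delta_gelfand_dorfman_algebra \<delta> scale mult bracket \<longrightarrow>
           transposed_poisson_algebra (\<delta> + 1) scale mult bracket) \<and>
         (\<delta> \<noteq> - 1 \<longrightarrow>
           transposed_poisson_algebra (\<delta> + 1) scale mult bracket \<longrightarrow>
           commutative_delta_gelfand_dorfman_algebra \<delta> scale mult bracket)"
proof (intro conjI impI)
  assume \<delta>: "\<delta> \<noteq> 1 / 2"
    and "commutative_delta_gelfand_dorfman_algebra \<delta> scale mult bracket"
  then interpret G: commutative_delta_gelfand_dorfman_algebra \<delta> scale mult bracket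
    by blast
  interpret L: commutative_associative_lie_algebra scale mult bracket
    by (rule G.commutative_associative_lie)
  have law: "L.leibniz_sum b a c
      = scale (\<delta> + 1) (mult b (bracket a c)) + scale \<delta> (L.cyclic_sum a b c)" for a b c
    using G.gelfand_dorfman[of a b c] by (simp only: L.gelfand_dorfman_iff)
  have "3 * \<delta> \<noteq> \<delta> + 1"
    using \<delta> by (auto simp: field_simps)
  then have S: "L.cyclic_sum a b c = 0" for a b c
    using L.cyclic_sum_eq_0[OF law] by blast
  show "transposed_poisson_algebra (\<delta> + 1) scale mult bracket"
  proof unfold_locales
    show "scale (\<delta> + 1) (mult x (bracket y z)) = bracket (mult x y) z + bracket y (mult x z)"
      for x y z
      using law[of x y z] by (simp add: S L.leibniz_sum_def)
  qed
next
  assume \<delta>: "\<delta> \<noteq> - 1"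
    and "transposed_poisson_algebra (\<delta> + 1) scale mult bracket"
  then interpret P: transposed_poisson_algebra "\<delta> + 1" scale mult bracket
    by blast
  interpret L: commutative_associative_lie_algebra scale mult bracket
    by unfold_locales
  have law: "L.leibniz_sum b a c
      = scale (\<delta> + 1) (mult b (bracket a c)) + scale 0 (L.cyclic_sum a b c)" for a b c
    by (simp add: L.leibniz_sum_def P.transposed_leibniz)
  have "3 * 0 \<noteq> \<delta> + 1"
    using \<delta> by (auto simp: eq_neg_iff_add_eq_0)
  then have S: "L.cyclic_sum a b c = 0" for a b c
    using L.cyclic_sum_eq_0[OF law] by blast
  show "commutative_delta_gelfand_dorfman_algebra \<delta> scale mult bracket"
  proof unfold_locales
    fix x y z
    show "mult x y = mult y x"
      by (rule P.commutative)
    show "mult (mult x y) z = mult (mult x z) y"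
      by (metis P.associative P.commutative)
    show "scale \<delta> (mult (mult x y) z) - mult x (mult y z)
        = scale \<delta> (mult (mult y x) z) - mult y (mult x z)"
      by (metis P.associative P.commutative)
    show "bracket x (mult y z) - bracket z (mult y x) + scale \<delta> (mult (bracket y x) z)
        - scale \<delta> (mult (bracket y z) x) - mult y (bracket x z) = 0"
      unfolding L.gelfand_dorfman_iff by (simp add: law S)
  qed
qed

end
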